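(* Let $I$ be a finite nonempty set of players, let $A_i$ be a finite nonempty set of actions for each $i\in I$, and let $A=\prod_{i\in I}A_i$. Let $(\sigma^*,D)$ be a goal, that is, $\sigma^*=(\sigma^*_i)_{i\in I}$ is a profile of behavior strategies and $D\subseteq A^{\mathbb{N}}$ is a Borel set, such that $\mathbf{P}_{\sigma^*}(D)=1$. Then $(\sigma^*,D)$ is $0$-testable.
   Context: $A^{<\mathbb{N}}$ is the set of finite sequences of elements of $A$ (including the empty sequence). A behavior strategy of player $i$ is a function $\sigma_i:A^{<\mathbb{N}}\to\Delta(A_i)$, where $\Delta(A_i)$ is the set of probability distributions on $A_i$; $\Sigma_i$ is the set of behavior strategies of player $i$. The space $A^{\mathbb{N}}$ carries the product topology (with $A$ discrete) and the Borel $\sigma$-algebra. A profile $\sigma=(\sigma_i)_{i\in I}\in\prod_i\Sigma_i$ induces a probability measure $\mathbf{P}_\sigma$ on $A^{\mathbb{N}}$: in each period $n$, given the action profiles $z^1,\dots,z^{n-1}$ chosen in the first $n-1$ periods, the players choose their actions independently, player $i$ according to $\sigma_i(\cdot\mid z^1,\dots,z^{n-1})$. $\mathbf{P}_{\sigma_i,\sigma^*_{-i}}$ denotes the measure induced when player $i$ uses $\sigma_i$ and every player $j\ne i$ uses $\sigma^*_j$. A blame function is a Borel function $f:D^c\to I$, where $D^c=A^{\mathbb{N}}\setminus D$. For $\delta\ge 0$, the goal $(\sigma^*,D)$ is $\delta$-testable if there exists a blame function $f$ such that for every player $i\in I$ and every $\sigma_i\in\Sigma_i$, $\mathbf{P}_{\sigma_i,\sigma^*_{-i}}(\{s\in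 D^c: f(s)\ne i\})\le\delta$. *)

theory Defs
  imports "HOL-Probability.Probability"
begin

definition profiles :: "'i set \<Rightarrow> ('i \<Rightarrow> 'a set) \<Rightarrow> ('i \<Rightarrow> 'a) set" where
  "profiles I A = (\<Pi>\<^sub>E i\<in>I. A i)"

text \<open>Periods are numbered from \<open>0\<close>, so a play \<open>s\<close> has action profile \<open>s n\<close> in period \<open>n + 1\<close>.\<close>

definition plays :: "'i set \<Rightarrow> ('i \<Rightarrow> 'a set) \<Rightarrow> (nat \<Rightarrow> 'i \<Rightarrow> 'a) set" where
  "plays I A = (\<Pi>\<^sub>E n\<in>UNIV. profiles I A)"

definition play_topology :: "'i set \<Rightarrow> ('i \<Rightarrow> 'a set) \<Rightarrow> (nat \<Rightarrow> 'i \<Rightarrow> 'a) topology" where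
  "play_topology I A = product_topology (\<lambda>_. discrete_topology (profiles I A)) UNIV"

definition play_borel :: "'i set \<Rightarrow> ('i \<Rightarrow> 'a set) \<Rightarrow> (nat \<Rightarrow> 'i \<Rightarrow> 'a) measure" where
  "play_borel I A = sigma (plays I A) {U. openin (play_topology I A) U}"

text \<open>A strategy is constrained only on histories that are finite sequences of action profiles;
  its values on other lists never matter.\<close>

type_synonym ('i, 'a) strategy = "('i \<Rightarrow> 'a) list \<Rightarrow> 'a pmf"

definition behavior_strategies ::
  "'i set \<Rightarrow> ('i \<Rightarrow> 'a set) \<Rightarrow> 'i \<Rightarrow> ('i, 'a) strategy set" where
  "behavior_strategies I A i = lists (profiles I A) \<rightarrow> {p. set_pmf p \<subseteq> A i}"

text \<open>The joint law of the next action profile after history \<open>h\<close>: independent choices of the players.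
  The default value \<open>undefined\<close> outside \<open>I\<close> agrees with the extensional functions
  that make up \<open>profiles I A\<close>.\<close>

definition next_profile ::
  "'i set \<Rightarrow> ('i \<Rightarrow> ('i, 'a) strategy) \<Rightarrow> ('i \<Rightarrow> 'a) list \<Rightarrow> ('i \<Rightarrow> 'a) pmf" where
  "next_profile I \<sigma> h = Pi_pmf I undefined (\<lambda>i. \<sigma> i h)"

definition period_kernel ::
  "'i set \<Rightarrow> ('i \<Rightarrow> 'a set) \<Rightarrow> ('i \<Rightarrow> ('i, 'a) strategy) \<Rightarrow> nat \<Rightarrow> (nat \<Rightarrow> 'i \<Rightarrow> 'a)
    \<Rightarrow> ('i \<Rightarrow> 'a) measure" where
  "period_kernel I A \<sigma> n s =
     restrict_space (measure_pmf (next_profile I \<sigma> (map s [0..<n]))) (profiles I A)"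

text \<open>The measure induced by a strategy profile is the limit given by the Ionescu-Tulcea theorem.
  The locale assumptions, the fact that its \<open>\<sigma>\<close>-algebra is the Borel one, and the formula for
  the probability of a cylinder are checked below.\<close>

definition play_measure ::
  "'i set \<Rightarrow> ('i \<Rightarrow> 'a set) \<Rightarrow> ('i \<Rightarrow> ('i, 'a) strategy) \<Rightarrow> (nat \<Rightarrow> 'i \<Rightarrow> 'a) measure" where
  "play_measure I A \<sigma> =
     projective_family.lim UNIV
       (Ionescu_Tulcea.CI (period_kernel I A \<sigma>) (\<lambda>_. count_space (profiles I A)))
       (\<lambda>_. count_space (profiles I A))"

definition goal ::
  "'i set \<Rightarrow> ('i \<Rightarrow> 'a set) \<Rightarrow> ('i \<Rightarrow> ('i, 'a) strategy) \<Rightarrow> (nat \<Rightarrow> 'i \<Rightarrow> 'a) set \<Rightarrow> bool" where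
  "goal I A \<sigma> D \<longleftrightarrow> (\<forall>i\<in>I. \<sigma> i \<in> behavior_strategies I A i) \<and> D \<in> sets (play_borel I A)"

definition blame_functions ::
  "'i set \<Rightarrow> ('i \<Rightarrow> 'a set) \<Rightarrow> (nat \<Rightarrow> 'i \<Rightarrow> 'a) set \<Rightarrow> ((nat \<Rightarrow> 'i \<Rightarrow> 'a) \<Rightarrow> 'i) set" where
  "blame_functions I A D =
     measurable (restrict_space (play_borel I A) (plays I A - D)) (count_space I)"

definition testable ::
  "real \<Rightarrow> 'i set \<Rightarrow> ('i \<Rightarrow> 'a set) \<Rightarrow> ('i \<Rightarrow> ('i, 'a) strategy) \<Rightarrow> (nat \<Rightarrow> 'i \<Rightarrow> 'a) set \<Rightarrow> bool"
  where
  "testable \<delta> I A \<sigma> D \<longleftrightarrow>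
     (\<exists>f\<in>blame_functions I A D. \<forall>i\<in>I. \<forall>\<tau>\<in>behavior_strategies I A i.
        measure (play_measure I A (\<sigma>(i := \<tau>))) {s \<in> plays I A - D. f s \<noteq> i} \<le> \<delta>)"


lemma profiles_finite:
  assumes "finite I" "\<forall>i\<in>I. finite (A i)"
  shows "finite (profiles I A)"
  using assms by (auto simp: profiles_def intro!: finite_PiE)

lemma set_pmf_next_profile:
  assumes "finite I" "\<forall>i\<in>I. \<sigma> i \<in> behavior_strategies I A i" "h \<in> lists (profiles I A)"
  shows "set_pmf (next_profile I \<sigma> h) \<subseteq> profiles I A"
proof
  fix a assume "a \<in> set_pmf (next_profile I \<sigma> h)"
  then have a: "\<And>i. i \<in> I \<Longrightarrow> a i \<in> set_pmf (\<sigma> i h)" "\<And>i. i \<notin> I \<Longrightarrow> a i = undefined"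
    using assms(1) by (auto simp: next_profile_def set_Pi_pmf PiE_dflt_def)
  have "set_pmf (\<sigma> i h) \<subseteq> A i" if "i \<in> I" for i
    using assms(2,3) that unfolding behavior_strategies_def by blast
  with a show "a \<in> profiles I A"
    unfolding profiles_def by (intro PiE_I) auto
qed

lemma Ionescu_Tulcea_period_kernel:
  assumes I: "finite I" and A: "\<forall>i\<in>I. finite (A i)"
    and \<sigma>: "\<forall>i\<in>I. \<sigma> i \<in> behavior_strategies I A i"
  shows "Ionescu_Tulcea (period_kernel I A \<sigma>) (\<lambda>_. count_space (profiles I A))"
proof -
  have fin: "finite (profiles I A)"
    using I A by (rule profiles_finite)
  have sp: "space (PiM {0..<n} (\<lambda>_. count_space (profiles I A))) = {0..<n} \<rightarrow>\<^sub>E profiles I A" for n :: nat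
    by (simp add: space_PiM)
  have prob: "prob_space (period_kernel I A \<sigma> n s)"
    if "s \<in> space (PiM {0..<n} (\<lambda>_. count_space (profiles I A)))" for n s
  proof -
    have h: "map s [0..<n] \<in> lists (profiles I A)"
      using that by (auto simp: sp PiE_iff)
    have "emeasure (measure_pmf (next_profile I \<sigma> (map s [0..<n]))) (profiles I A) = 1"
      using set_pmf_next_profile[OF I \<sigma> h]
      by (subst measure_pmf.emeasure_eq_1_AE) (auto simp: AE_measure_pmf_iff)
    then show ?thesis
      unfolding period_kernel_def
      by (intro prob_spaceI) (simp add: emeasure_restrict_space space_restrict_space)
  qed
  have "period_kernel I A \<sigma> n \<in> PiM {0..<n} (\<lambda>_. count_space (profiles I A)) \<rightarrow>\<^sub>M
      subprob_algebra (count_space (profiles I A))" for n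
  proof -
    have *: "PiM {0..<n} (\<lambda>_. count_space (profiles I A)) = count_space ({0..<n} \<rightarrow>\<^sub>E profiles I A)"
      using fin by (intro count_space_PiM_finite) (auto intro: countable_finite)
    have "period_kernel I A \<sigma> n s \<in> space (subprob_algebra (count_space (profiles I A)))"
      if "s \<in> {0..<n} \<rightarrow>\<^sub>E profiles I A" for s
    proof -
      have "sets (period_kernel I A \<sigma> n s) = Pow (profiles I A)"
        by (auto simp: period_kernel_def sets_restrict_space)
      then show ?thesis
        using prob[of s n] that
        by (auto simp: space_subprob_algebra sp intro: prob_space_imp_subprob_space)
    qed
    then show ?thesis
      unfolding * by simp
  qed
  with prob show ?thesis
    by (intro Ionescu_Tulcea.intro)
qed

lemma topspace_play_topology: "topspace (play_topology I A) = plays I A"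
  by (simp add: play_topology_def plays_def)

lemma open_plays_subset: "{U. openin (play_topology I A) U} \<subseteq> Pow (plays I A)"
  using openin_subset[of "play_topology I A"] by (auto simp only: topspace_play_topology Pow_iff)

lemma space_play_borel [simp]: "space (play_borel I A) = plays I A"
  unfolding play_borel_def by (rule space_measure_of[OF open_plays_subset])

lemma sets_play_borel: "sets (play_borel I A) = sigma_sets (plays I A) {U. openin (play_topology I A) U}"
  unfolding play_borel_def by (rule sets_measure_of[OF open_plays_subset])

lemma openin_play_cylinder:
  assumes "X \<subseteq> profiles I A"
  shows "openin (play_topology I A) {s \<in> plays I A. s n \<in> X}"
proof -
  have "{s \<in> plays I A. s n \<in> X} = PiE UNIV (\<lambda>m. if m = n then X else profiles I A)"
    using assms unfolding plays_def by (intro set_eqI) (simp add: PiE_iff, metis subsetD)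
  moreover have "finite {m. (if m = n then X else profiles I A) \<noteq> profiles I A}"
    by (rule finite_subset[of _ "{n}"]) (auto split: if_splits)
  ultimately show ?thesis
    using assms by (simp add: play_topology_def openin_PiE_gen)
qed

lemma sets_play_borel_eq_PiM:
  assumes I: "finite I" and A: "\<forall>i\<in>I. finite (A i)"
  shows "sets (play_borel I A) = sets (PiM UNIV (\<lambda>_. count_space (profiles I A)))"
proof
  let ?M = "PiM (UNIV :: nat set) (\<lambda>_. count_space (profiles I A))"
  have sp: "space ?M = plays I A"
    by (simp add: space_PiM plays_def)
  show "sets ?M \<subseteq> sets (play_borel I A)"
    using openin_play_cylinder
    by (intro sets_PiM_in_sets) (auto simp: plays_def[symmetric] sets_play_borel intro!: sigma_sets.Basic)
  have "U \<in> sets ?M" if U: "openin (play_topology I A) U" for U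
  proof -
    define cyl where "cyl h = {s \<in> space ?M. \<forall>k<length h. s k = h ! k}" for h
    define H where "H = {h \<in> lists (profiles I A). cyl h \<subseteq> U}"
    have count: "countable H"
      using profiles_finite[OF I A] by (auto simp: H_def countable_finite)
    have cyl: "cyl h \<in> sets ?M" if "h \<in> H" for h
    proof -
      have "h ! k \<in> profiles I A" if "k < length h" for k
        using \<open>h \<in> H\<close> that by (auto simp: H_def)
      then have "{s \<in> space ?M. s k = h ! k} \<in> sets ?M" if "k < length h" for k
        using that measurable_sets[OF measurable_component_singleton[of k UNIV "\<lambda>_. count_space (profiles I A)"], of "{h ! k}"]
        by (auto simp: vimage_def Int_def conj_commute)
      then have "{s \<in> space ?M. \<forall>k\<in>{..<length h}. s k = h ! k} \<in> sets ?M"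
        by (intro sets.sets_Collect_finite_All) auto
      then show ?thesis
        by (simp add: cyl_def Ball_def)
    qed
    have UH: "U = (\<Union>h\<in>H. cyl h)"
    proof
      show "(\<Union>h\<in>H. cyl h) \<subseteq> U"
        by (auto simp: H_def)
      show "U \<subseteq> (\<Union>h\<in>H. cyl h)"
      proof
        fix x assume x: "x \<in> U"
        then obtain V where fin: "finite {i. V i \<noteq> profiles I A}" and xV: "x \<in> PiE UNIV V"
          and VU: "PiE UNIV V \<subseteq> U"
          using U unfolding play_topology_def openin_product_topology_alt by auto
        have xp: "x \<in> plays I A"
          using U x openin_subset[of "play_topology I A"] by (auto simp: topspace_play_topology)
        obtain n where n: "\<forall>i\<in>{i. V i \<noteq> profiles I A}. i < n"
          using fin finite_nat_set_iff_bounded by blast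
        define h where "h = map x [0..<n]"
        have "cyl h \<subseteq> PiE UNIV V"
        proof
          fix s assume s: "s \<in> cyl h"
          have "s k \<in> V k" for k
          proof (cases "V k = profiles I A")
            case True
            then show ?thesis using s by (auto simp: cyl_def sp plays_def)
          next
            case False
            then have "k < n" using n by auto
            then have "s k = x k" using s by (auto simp: cyl_def h_def)
            then show ?thesis using xV by auto
          qed
          then show "s \<in> PiE UNIV V" by auto
        qed
        with VU have "cyl h \<subseteq> U"
          by (rule subset_trans[rotated])
        moreover have "h \<in> lists (profiles I A)"
          using xp by (auto simp: h_def plays_def PiE_iff)
        ultimately have "h \<in> H"
          unfolding H_def by (intro CollectI conjI)
        moreover have "x \<in> cyl h"
          using xp by (auto simp: cyl_def h_def sp)
        ultimately show "x \<in> (\<Union>h\<in>H. cyl h)"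
          by (rule UN_I)
      qed
    qed
    show ?thesis
      unfolding UH by (rule sets.countable_UN''[OF count cyl])
  qed
  then show "sets (play_borel I A) \<subseteq> sets ?M"
    unfolding sets_play_borel sp[symmetric] by (intro sets.sigma_sets_subset) auto
qed

context
  fixes I :: "'i set" and A :: "'i \<Rightarrow> 'a set" and \<sigma> :: "'i \<Rightarrow> ('i, 'a) strategy"
  assumes I: "finite I" and A: "\<forall>i\<in>I. finite (A i)"
    and \<sigma>: "\<forall>i\<in>I. \<sigma> i \<in> behavior_strategies I A i"
begin

interpretation IT: Ionescu_Tulcea "period_kernel I A \<sigma>" "\<lambda>_. count_space (profiles I A)"
  using I A \<sigma> by (rule Ionescu_Tulcea_period_kernel)

lemma sets_play_measure: "sets (play_measure I A \<sigma>) = sets (play_borel I A)"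
  unfolding play_measure_def IT.PF.sets_lim using sets_play_borel_eq_PiM[OF I A] by simp

lemma space_play_measure: "space (play_measure I A \<sigma>) = plays I A"
  using sets_eq_imp_space_eq[OF sets_play_measure] by simp

lemma emeasure_play_measure_cylinder:
  assumes x: "x \<in> plays I A"
  shows "emeasure (play_measure I A \<sigma>) {s \<in> plays I A. \<forall>k<n. s k = x k} =
           (\<Prod>k<n. \<Prod>i\<in>I. ennreal (pmf (\<sigma> i (map x [0..<k])) (x k i)))"
proof -
  let ?N = "\<lambda>n. PiM {0..<n} (\<lambda>_. count_space (profiles I A))"
  let ?p = "\<lambda>k. ennreal (pmf (next_profile I \<sigma> (map x [0..<k])) (x k))"
  have xk: "x k \<in> profiles I A" for k
    using x by (auto simp: plays_def)
  have fin: "finite (profiles I A)"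
    using I A by (rule profiles_finite)
  have N: "?N n = count_space ({0..<n} \<rightarrow>\<^sub>E profiles I A)" for n :: nat
    using fin by (intro count_space_PiM_finite) (auto intro: countable_finite)
  have r: "restrict x {0..<n} \<in> {0..<n} \<rightarrow>\<^sub>E profiles I A" for n
    using xk by auto
  have C: "emeasure (IT.C 0 n (\<lambda>_. undefined)) {restrict x {0..<n}} = (\<Prod>k<n. ?p k)" for n
  proof (induction n)
    case 0
    then show ?case by (simp add: restrict_def space_PiM PiM_empty)
  next
    case (Suc n)
    let ?C = "IT.C 0 n (\<lambda>_. undefined)"
    have sC: "space ?C = {0..<n} \<rightarrow>\<^sub>E profiles I A"
      using IT.space_C[of "\<lambda>_. undefined" 0 n] by (simp add: space_PiM)
    have setC: "sets ?C = sets (?N n)"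
      using IT.sets_C[of "\<lambda>_. undefined" 0 n] by (simp add: space_PiM)
    have eP: "emeasure (IT.eP n \<omega>) {restrict x {0..<Suc n}} = ?p n * indicator {restrict x {0..<n}} \<omega>"
      if \<omega>: "\<omega> \<in> {0..<n} \<rightarrow>\<^sub>E profiles I A" for \<omega>
    proof -
      have "emeasure (IT.eP n \<omega>) {restrict x {0..<Suc n}} =
          emeasure (period_kernel I A \<sigma> n \<omega>)
            ((\<lambda>y. fun_upd \<omega> n y) -` {restrict x {0..<Suc n}} \<inter> profiles I A)"
        using \<omega> r[of "Suc n"] by (subst IT.emeasure_eP) (auto simp: space_PiM N)
      also have "((\<lambda>y. fun_upd \<omega> n y) -` {restrict x {0..<Suc n}} \<inter> profiles I A) =
          (if \<omega> = restrict x {0..<n} then {x n} else {})"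
      proof (cases "\<omega> = restrict x {0..<n}")
        case True
        then show ?thesis
          using xk[of n]
          by (intro set_eqI) (auto simp: restrict_def dest: fun_cong[of _ _ n])
      next
        case False
        have "\<omega> = restrict x {0..<n}" if eq: "fun_upd \<omega> n y = restrict x {0..<Suc n}" for y
        proof
          fix k
          show "\<omega> k = restrict x {0..<n} k"
            using fun_cong[OF eq, of k] \<omega> by (cases "k < n") (auto simp: PiE_iff extensional_def)
        qed
        with False show ?thesis by auto
      qed
      also have "emeasure (period_kernel I A \<sigma> n \<omega>) \<dots> = ?p n * indicator {restrict x {0..<n}} \<omega>"
      proof (cases "\<omega> = restrict x {0..<n}")
        case True
        then have hist: "map \<omega> [0..<n] = map x [0..<n]" by simp
        have "emeasure (period_kernel I A \<sigma> n \<omega>) {x n} = ?p n"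
          unfolding period_kernel_def hist using xk[of n]
          by (simp add: emeasure_restrict_space emeasure_pmf_single)
        with True show ?thesis by simp
      qed simp
      finally show ?thesis .
    qed
    have "emeasure (IT.C 0 (Suc n) (\<lambda>_. undefined)) {restrict x {0..<Suc n}} =
        (\<integral>\<^sup>+\<omega>. emeasure (IT.eP n \<omega>) {restrict x {0..<Suc n}} \<partial>?C)"
    proof -
      have "IT.eP n \<in> ?C \<rightarrow>\<^sub>M subprob_algebra (?N (Suc n))"
        using IT.measurable_eP[of n] measurable_cong_sets[OF setC refl] by blast
      moreover have "space ?C \<noteq> {}"
        using r[of n] unfolding sC by blast
      moreover have "{restrict x {0..<Suc n}} \<in> sets (?N (Suc n))"
        using r[of "Suc n"] by (simp add: N)
      ultimately have "emeasure (?C \<bind> IT.eP n) {restrict x {0..<Suc n}} =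
          (\<integral>\<^sup>+\<omega>. emeasure (IT.eP n \<omega>) {restrict x {0..<Suc n}} \<partial>?C)"
        by (intro emeasure_bind)
      then show ?thesis
        by simp
    qed
    also have "\<dots> = (\<integral>\<^sup>+\<omega>. ?p n * indicator {restrict x {0..<n}} \<omega> \<partial>?C)"
      by (intro nn_integral_cong eP) (simp add: sC)
    also have "\<dots> = ?p n * emeasure ?C {restrict x {0..<n}}"
      using r[of n] by (intro nn_integral_cmult_indicator) (simp add: setC N)
    also have "\<dots> = (\<Prod>k<Suc n. ?p k)"
      unfolding Suc by (simp add: mult.commute)
    finally show ?case .
  qed
  have "{s \<in> plays I A. \<forall>k<n. s k = x k} = IT.PF.emb UNIV {0..<n} {restrict x {0..<n}}"
  proof -
    have "(\<forall>k<n. s k = x k) \<longleftrightarrow> restrict s {0..<n} = restrict x {0..<n}" for s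
      by (metis atLeastLessThan_iff le0 restrict_apply' restrict_ext)
    then show ?thesis
      by (auto simp: prod_emb_def plays_def space_PiM)
  qed
  then have "emeasure (play_measure I A \<sigma>) {s \<in> plays I A. \<forall>k<n. s k = x k} =
      emeasure (IT.CI {0..<n}) {restrict x {0..<n}}"
    unfolding play_measure_def using r[of n] by (simp add: IT.lim N)
  also have "\<dots> = emeasure (IT.C 0 n (\<lambda>_. undefined)) {restrict x {0..<n}}"
    using r[of n] by (subst IT.emeasure_CI[of _ n]) (auto simp: N prod_emb_id)
  also have "\<dots> = (\<Prod>k<n. ?p k)"
    by (rule C)
  also have "\<dots> = (\<Prod>k<n. \<Prod>i\<in>I. ennreal (pmf (\<sigma> i (map x [0..<k])) (x k i)))"
    using I xk by (intro prod.cong refl)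
      (auto simp: next_profile_def pmf_Pi profiles_def PiE_iff extensional_def prod_ennreal)
  finally show ?thesis .
qed

lemma prob_space_play_measure: "prob_space (play_measure I A \<sigma>)"
proof -
  obtain x where "x \<in> plays I A"
    using IT.space_PiM_not_empty by (auto simp: space_PiM plays_def)
  from emeasure_play_measure_cylinder[OF this, of 0] show ?thesis
    by (intro prob_spaceI) (simp add: space_play_measure)
qed

end

end

theory Submission
  imports Defs "HOL-Analysis.Function_Metric"
begin

text \<open>
  Write \<open>E\<close> for the complement of \<open>D\<close>, a null set of \<open>P\<^sub>\<sigma>\<close>. A pair \<open>(i, \<tau>)\<close> stands for the
  deviation in which player \<open>i\<close> switches to \<open>\<tau>\<close>, and \<open>P\<^bsub>i,\<tau>\<^esub>\<close> for the measure it induces.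

  Why can two deviators be told apart? The probability of a history is a product over periods and
  players, so for distinct players \<open>i\<close> and \<open>j\<close>
  \<open>P\<^bsub>i,\<tau>\<^esub>(h) * P\<^bsub>j,\<rho>\<^esub>(h) = P\<^sub>\<sigma>(h) * P\<^bsub>(i,\<tau>),(j,\<rho>)\<^esub>(h)\<close>,
  where in the last factor both players deviate (\<open>history_prob_exchange\<close>). By the Cauchy--Schwarz
  inequality, on a disjoint family of cylinders of total \<open>P\<^sub>\<sigma>\<close>-probability at most \<open>\<epsilon>\<close> the affinity
  of the two deviations, the sum of \<open>sqrt (P\<^bsub>i,\<tau>\<^esub>(h) P\<^bsub>j,\<rho>\<^esub>(h))\<close>, is at most \<open>sqrt \<epsilon>\<close>. Random
  choices of \<open>\<tau>\<close> and \<open>\<rho>\<close> only average the last factor, so the bound persists for mixtures of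
  deviations. Hence an observer who knows how likely the deviations are, and blames the most likely
  deviator whenever one of these cylinders is reached, errs with probability of order \<open>sqrt \<epsilon>\<close>
  (\<open>best_reply\<close>).

  The observer needs one rule that is good against all deviations at once. This exchange of
  quantifiers is a minimax argument: playing best replies against the deviations that have done
  best so far gives a sequence of rules whose average is good against every deviation from a finite
  set (\<open>approachability\<close>), and a plurality vote among them is a deterministic rule that loses only a
  factor two (\<open>plurality_vote\<close>). For infinitely many histories and deviations, Tychonoff's theorem
  for the space of all rules applies, because the requirement for one deviation and
  finitely many histories constrains finitely many coordinates (\<open>blame_all_deviations\<close>).

  The null set \<open>E\<close> is covered by disjoint cylinders of arbitrarily small total probability
  (\<open>null_set_cover\<close>). This yields rules \<open>f\<^sub>n\<close>, each applied on a cover of \<open>E\<close>, that blame an innocent player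
  with probability at most \<open>(1/2)\<^sup>n\<close> under every unilateral deviation. By the Borel--Cantelli lemma a
  player who is not the deviator is almost surely blamed only finitely often on \<open>E\<close>, so blaming
  some player whom infinitely many \<open>f\<^sub>n\<close> blame is almost surely right
  (\<open>testable_if_complement_null\<close>).
\<close>

section \<open>A minimax principle for finitely many losses\<close>

text \<open>
  The potential argument behind Blackwell's approachability theorem. Choose the next point as a
  best reply to the weights given by the positive parts of the accumulated excess losses. Then one
  step changes the squared norm of that positive part by a first-order term that is at most zero and
  a bounded second-order term, so the squared norm grows at most linearly in time and the norm
  itself is of smaller order than the time.
\<close>
lemma approachability:
  fixes r :: "'k \<Rightarrow> 'x \<Rightarrow> real"
  assumes K: "finite K" and r: "\<And>k x. k \<in> K \<Longrightarrow> x \<in> X \<Longrightarrow> 0 \<le> r k x \<and> r k x \<le> 1"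
    and c: "0 \<le> c" and \<eta>: "0 < \<eta>"
    and reply: "\<And>q. (\<And>k. k \<in> K \<Longrightarrow> 0 \<le> q k) \<Longrightarrow>
      \<exists>x\<in>X. (\<Sum>k\<in>K. q k * r k x) \<le> c * (\<Sum>k\<in>K. q k)"
  shows "\<exists>T>0. \<exists>x. (\<forall>t. x t \<in> X) \<and> (\<forall>k\<in>K. (\<Sum>t<T. r k (x t)) \<le> real T * (c + \<eta>))"
proof -
  \<comment> \<open>accumulated excess loss over the target \<open>c\<close>; \<open>B\<close> bounds the second-order term of one step\<close>
  define S where "S x T k = (\<Sum>t<T. r k (x t) - c)" for x :: "nat \<Rightarrow> 'x" and T k
  define B where "B = real (card K) * (1 + c)\<^sup>2"
  have "\<exists>x. (\<forall>t. x t \<in> X) \<and> (\<Sum>k\<in>K. (max 0 (S x T k))\<^sup>2) \<le> B * real T" for T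
  proof (induction T)
    case 0
    obtain x where "x \<in> X" using reply[of "\<lambda>_. 0"] by auto
    then show ?case by (intro exI[of _ "\<lambda>_. x"]) (simp add: S_def)
  next
    case (Suc T)
    then obtain x where x: "\<forall>t. x t \<in> X" and IH: "(\<Sum>k\<in>K. (max 0 (S x T k))\<^sup>2) \<le> B * real T"
      by blast
    \<comment> \<open>the gradient of half the potential at the current excess\<close>
    define q where "q k = max 0 (S x T k)" for k
    obtain y where y: "y \<in> X" and yq: "(\<Sum>k\<in>K. q k * r k y) \<le> c * (\<Sum>k\<in>K. q k)"
      using reply[of q] by (auto simp: q_def)
    define x' where "x' = x(T := y)"
    have S': "S x' (Suc T) k = S x T k + (r k y - c)" for k
      by (simp add: S_def x'_def)
    have step: "(max 0 (S x' (Suc T) k))\<^sup>2 \<le> (q k)\<^sup>2 + 2 * (q k * (r k y - c)) + (1 + c)\<^sup>2"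
      if "k \<in> K" for k
    proof -
      have "(max 0 (a + b))\<^sup>2 \<le> (max 0 a + b)\<^sup>2" for a b :: real
        by (rule abs_le_square_iff[THEN iffD1]) (auto simp: max_def)
      then have "(max 0 (S x' (Suc T) k))\<^sup>2 \<le> (q k + (r k y - c))\<^sup>2"
        unfolding S' q_def .
      also have "\<dots> = (q k)\<^sup>2 + 2 * (q k * (r k y - c)) + (r k y - c)\<^sup>2"
        by (simp add: power2_eq_square algebra_simps)
      also have "(r k y - c)\<^sup>2 \<le> (1 + c)\<^sup>2"
        using r[OF that y] c by (intro abs_le_square_iff[THEN iffD1]) auto
      finally show ?thesis by simp
    qed
    have "(\<Sum>k\<in>K. (max 0 (S x' (Suc T) k))\<^sup>2)
        \<le> (\<Sum>k\<in>K. (q k)\<^sup>2 + 2 * (q k * (r k y - c)) + (1 + c)\<^sup>2)"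
      by (intro sum_mono step)
    also have "\<dots> = (\<Sum>k\<in>K. (q k)\<^sup>2) + 2 * ((\<Sum>k\<in>K. q k * r k y) - c * (\<Sum>k\<in>K. q k)) + B"
      by (simp add: sum.distrib B_def sum_distrib_left right_diff_distrib sum_subtractf mult_ac)
    also have "\<dots> \<le> B * real T + B"
      using IH yq by (simp add: q_def)
    finally have "(\<Sum>k\<in>K. (max 0 (S x' (Suc T) k))\<^sup>2) \<le> B * real (Suc T)"
      by (simp add: algebra_simps)
    moreover have "\<forall>t. x' t \<in> X" using x y by (simp add: x'_def)
    ultimately show ?case by blast
  qed
  note potential = this
  \<comment> \<open>from this time on, \<open>sqrt (B * T)\<close> is at most \<open>T * \<eta>\<close>\<close>
  obtain T :: nat where T: "T > B / \<eta>\<^sup>2" by (rule reals_Archimedean2[THEN exE])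
  have T0: "T > 0" using T le_less_trans[of 0 "B / \<eta>\<^sup>2" "real T"] by (simp add: B_def)
  obtain x where x: "\<forall>t. x t \<in> X" and pot: "(\<Sum>k\<in>K. (max 0 (S x T k))\<^sup>2) \<le> B * real T"
    using potential[of T] by blast
  have "(\<Sum>t<T. r k (x t)) \<le> real T * (c + \<eta>)" if k: "k \<in> K" for k
  proof -
    have "(max 0 (S x T k))\<^sup>2 \<le> (\<Sum>k\<in>K. (max 0 (S x T k))\<^sup>2)"
      using K k by (intro member_le_sum) auto
    also have "\<dots> \<le> B * real T" by (rule pot)
    also have "\<dots> \<le> (\<eta>\<^sup>2 * real T) * real T"
      using T \<eta> by (intro mult_right_mono) (auto simp: field_simps)
    also have "\<dots> = (real T * \<eta>)\<^sup>2" by (simp add: power2_eq_square)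
    finally have "max 0 (S x T k) \<le> real T * \<eta>"
      using \<eta> by (intro power2_le_imp_le[of "max 0 (S x T k)"]) auto
    then show ?thesis by (simp add: S_def sum_subtractf algebra_simps)
  qed
  with T0 x show ?thesis by blast
qed

section \<open>Blaming one of finitely many players on observing a discrete outcome\<close>

text \<open>
  The game enters the minimax argument only through the following data. An outcome from \<open>H\<close> has
  probability \<open>w h\<close> if nobody deviates, \<open>u k h\<close> under the deviation \<open>k\<close> of the player \<open>pl k\<close>, and
  \<open>z k l h\<close> if two players deviate by \<open>k\<close> and \<open>l\<close>. The outcomes in \<open>H\<close> need not exhaust all
  possibilities, so the total masses are bounded rather than equal to one; \<open>\<epsilon>\<close> bounds the
  probability of having to blame somebody when everybody complies.
\<close>

locale blame_problem =
  fixes I :: "'i set" and H :: "'h set" and K :: "'k set" and pl :: "'k \<Rightarrow> 'i"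
    and w :: "'h \<Rightarrow> real" and u :: "'k \<Rightarrow> 'h \<Rightarrow> real" and z :: "'k \<Rightarrow> 'k \<Rightarrow> 'h \<Rightarrow> real"
    and \<epsilon> :: real
  assumes finite_I: "finite I" and I_nonempty: "I \<noteq> {}"
    and pl: "k \<in> K \<Longrightarrow> pl k \<in> I"
    and w_nonneg: "0 \<le> w h" and u_nonneg: "0 \<le> u k h" and z_nonneg: "0 \<le> z k l h"
    and exchange: "k \<in> K \<Longrightarrow> l \<in> K \<Longrightarrow> pl k \<noteq> pl l \<Longrightarrow> u k h * u l h = w h * z k l h"
    and sum_w: "finite F \<Longrightarrow> F \<subseteq> H \<Longrightarrow> sum w F \<le> \<epsilon>"
    and sum_u: "finite F \<Longrightarrow> F \<subseteq> H \<Longrightarrow> k \<in> K \<Longrightarrow> sum (u k) F \<le> 1"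
    and sum_z: "finite F \<Longrightarrow> F \<subseteq> H \<Longrightarrow> k \<in> K \<Longrightarrow> l \<in> K \<Longrightarrow> pl k \<noteq> pl l \<Longrightarrow> sum (z k l) F \<le> 1"
    and \<epsilon>_pos: "0 < \<epsilon>"
begin

definition wrong_blame :: "'h set \<Rightarrow> 'k \<Rightarrow> ('h \<Rightarrow> 'i) \<Rightarrow> real" where
  "wrong_blame F k g = (\<Sum>h\<in>F. of_bool (g h \<noteq> pl k) * u k h)"

text \<open>
  With \<open>R i h\<close> the weight of outcome \<open>h\<close> under a random deviation of player \<open>i\<close>, the rule that
  blames a player maximizing \<open>R i h\<close> is optimal. A player \<open>i\<close> who is not blamed contributes to the error
  \<open>R i h \<le> sqrt (R i h * R j h)\<close>, where \<open>j\<close> is the blamed player, and for distinct players the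
  product under the root is \<open>w h\<close> times a mixture of the \<open>z k l h\<close>. Summing over outcomes with the
  Cauchy--Schwarz inequality gives \<open>sqrt \<epsilon>\<close> for each pair of players. Mixing before taking the
  root is what makes the bound independent of the number of deviations.
\<close>

lemma best_reply:
  assumes F: "finite F" "F \<subseteq> H" and L: "finite L" "L \<subseteq> K" and q: "\<And>k. k \<in> L \<Longrightarrow> 0 \<le> q k"
  shows "\<exists>g\<in>{g. \<forall>h. g h \<in> I}. (\<Sum>k\<in>L. q k * wrong_blame F k g) \<le> (real (card I))\<^sup>2 * sqrt \<epsilon> * (\<Sum>k\<in>L. q k)"
proof -
  let ?L = "\<lambda>i. {k \<in> L. pl k = i}"
  define Q where "Q = (\<Sum>k\<in>L. q k)"
  define R where "R i h = (\<Sum>k\<in>?L i. q k * u k h)" for i h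
  have Q0: "0 \<le> Q" using q by (auto simp: Q_def intro: sum_nonneg)
  have R0: "0 \<le> R i h" for i h
    using q u_nonneg by (auto simp: R_def intro!: sum_nonneg)
  have "\<exists>j\<in>I. \<forall>i\<in>I. R i h \<le> R j h" for h
  proof -
    have "Max ((\<lambda>i. R i h) ` I) \<in> (\<lambda>i. R i h) ` I"
      using finite_I I_nonempty by (intro Max_in) auto
    then obtain j where "j \<in> I" "R j h = Max ((\<lambda>i. R i h) ` I)" by (auto simp: image_iff)
    then show ?thesis using finite_I by (intro bexI[of _ j]) auto
  qed
  then obtain g where g: "\<And>h. g h \<in> I" "\<And>h i. i \<in> I \<Longrightarrow> R i h \<le> R (g h) h"
    by metis
  have affinity: "(\<Sum>h\<in>F. sqrt (R i h * R j h)) \<le> sqrt \<epsilon> * Q" if "i \<noteq> j" for i j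
  proof -
    define Z where "Z h = (\<Sum>k\<in>?L i. \<Sum>l\<in>?L j. q k * q l * z k l h)" for h
    have Z0: "0 \<le> Z h" for h
      using q z_nonneg by (auto simp: Z_def intro!: sum_nonneg)
    have RZ: "R i h * R j h = w h * Z h" for h
    proof -
      have "R i h * R j h = (\<Sum>k\<in>?L i. \<Sum>l\<in>?L j. q k * q l * (u k h * u l h))"
        by (simp add: R_def sum_product mult_ac)
      also have "\<dots> = (\<Sum>k\<in>?L i. \<Sum>l\<in>?L j. q k * q l * (w h * z k l h))"
        using L that by (intro sum.cong refl arg_cong2[of _ _ _ _ "(*)"] exchange) auto
      also have "\<dots> = w h * Z h"
        by (simp add: Z_def sum_distrib_left mult_ac)
      finally show ?thesis .
    qed
    have part: "0 \<le> sum q (?L i)" "sum q (?L i) \<le> Q" for i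
      using q L by (auto simp: Q_def intro!: sum_nonneg sum_mono2)
    have "(\<Sum>h\<in>F. Z h) = (\<Sum>k\<in>?L i. \<Sum>l\<in>?L j. q k * q l * (\<Sum>h\<in>F. z k l h))"
      unfolding Z_def by (subst sum.swap, rule sum.cong[OF refl], subst sum.swap)
        (simp add: sum_distrib_left)
    also have "\<dots> \<le> (\<Sum>k\<in>?L i. \<Sum>l\<in>?L j. q k * q l * 1)"
      using L that q by (intro sum_mono mult_left_mono sum_z F) auto
    also have "\<dots> = sum q (?L i) * sum q (?L j)"
      by (simp add: sum_product)
    also have "\<dots> \<le> Q * Q"
      using part Q0 by (intro mult_mono) auto
    finally have ZQ: "(\<Sum>h\<in>F. Z h) \<le> Q * Q" .
    have "(\<Sum>h\<in>F. sqrt (R i h * R j h)) = (\<Sum>h\<in>F. \<bar>sqrt (w h)\<bar> * \<bar>sqrt (Z h)\<bar>)"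
      using w_nonneg Z0 by (simp add: RZ real_sqrt_mult)
    also have "\<dots> \<le> L2_set (\<lambda>h. sqrt (w h)) F * L2_set (\<lambda>h. sqrt (Z h)) F"
      by (rule L2_set_mult_ineq)
    also have "\<dots> = sqrt (sum w F) * sqrt (\<Sum>h\<in>F. Z h)"
      using w_nonneg Z0 by (simp add: L2_set_def)
    also have "\<dots> \<le> sqrt \<epsilon> * sqrt (Q * Q)"
      using sum_w[OF F] ZQ w_nonneg Z0 \<epsilon>_pos
      by (intro mult_mono real_sqrt_le_mono) (auto intro: sum_nonneg)
    finally show ?thesis using Q0 by simp
  qed
  \<comment> \<open>summing over all \<open>j\<close> covers every value of the blamed player \<open>g h\<close>, which varies with \<open>h\<close>\<close>
  have pointwise: "(\<Sum>k\<in>L. q k * (of_bool (g h \<noteq> pl k) * u k h)) \<le> (\<Sum>i\<in>I. \<Sum>j\<in>I. of_bool (i \<noteq> j) * sqrt (R i h * R j h))" for h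
  proof -
    have "(\<Sum>k\<in>L. q k * (of_bool (g h \<noteq> pl k) * u k h))
        = (\<Sum>i\<in>I. \<Sum>k\<in>?L i. q k * (of_bool (g h \<noteq> pl k) * u k h))"
      using L finite_I pl by (intro sum.group[symmetric]) auto
    also have "\<dots> = (\<Sum>i\<in>I. of_bool (g h \<noteq> i) * R i h)"
      by (auto simp: R_def sum_distrib_left intro!: sum.cong)
    also have "\<dots> \<le> (\<Sum>i\<in>I. of_bool (i \<noteq> g h) * sqrt (R i h * R (g h) h))"
    proof (intro sum_mono)
      fix i assume "i \<in> I"
      then have "R i h * R i h \<le> R i h * R (g h) h"
        using g(2) R0 by (intro mult_left_mono) auto
      then have "R i h \<le> sqrt (R i h * R (g h) h)"
        by (intro real_le_rsqrt) (simp add: power2_eq_square)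
      then show "of_bool (g h \<noteq> i) * R i h \<le> of_bool (i \<noteq> g h) * sqrt (R i h * R (g h) h)"
        by auto
    qed
    also have "\<dots> \<le> (\<Sum>i\<in>I. \<Sum>j\<in>I. of_bool (i \<noteq> j) * sqrt (R i h * R j h))"
      using finite_I g(1)[of h] R0
      by (intro sum_mono member_le_sum[where f="\<lambda>j. of_bool (_ \<noteq> j) * sqrt (R _ h * R j h)"]) auto
    finally show ?thesis .
  qed
  have "(\<Sum>k\<in>L. q k * wrong_blame F k g) = (\<Sum>h\<in>F. \<Sum>k\<in>L. q k * (of_bool (g h \<noteq> pl k) * u k h))"
    unfolding wrong_blame_def sum_distrib_left by (rule sum.swap)
  also have "\<dots> \<le> (\<Sum>h\<in>F. \<Sum>i\<in>I. \<Sum>j\<in>I. of_bool (i \<noteq> j) * sqrt (R i h * R j h))"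
    by (intro sum_mono pointwise)
  also have "\<dots> = (\<Sum>i\<in>I. \<Sum>j\<in>I. of_bool (i \<noteq> j) * (\<Sum>h\<in>F. sqrt (R i h * R j h)))"
    by (subst sum.swap, rule sum.cong[OF refl], subst sum.swap) (simp add: sum_distrib_left)
  also have "\<dots> \<le> (\<Sum>i\<in>I. \<Sum>j\<in>I. sqrt \<epsilon> * Q)"
    using affinity Q0 \<epsilon>_pos by (intro sum_mono) auto
  also have "\<dots> = (real (card I))\<^sup>2 * sqrt \<epsilon> * Q"
    by (simp add: power2_eq_square)
  finally show ?thesis using g(1) by (auto simp: Q_def)
qed

text \<open>
  If the final rule blames somebody other than \<open>i\<close>, then \<open>i\<close> got at most half of the votes, so at
  least half of the voting rules blamed somebody other than \<open>i\<close> as well. The error of the vote is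
  therefore at most twice the average error; the other factor two is the slack \<open>\<eta> = c\<close> in
  the approachability lemma.
\<close>

lemma plurality_vote:
  assumes F: "finite F" "F \<subseteq> H" and L: "finite L" "L \<subseteq> K"
  shows "\<exists>g. (\<forall>h. g h \<in> I) \<and> (\<forall>k\<in>L. wrong_blame F k g \<le> 4 * (real (card I))\<^sup>2 * sqrt \<epsilon>)"
proof -
  define c where "c = (real (card I))\<^sup>2 * sqrt \<epsilon>"
  have c0: "0 < c" using finite_I I_nonempty \<epsilon>_pos by (simp add: c_def card_gt_0_iff)
  have bounds: "0 \<le> wrong_blame F k g \<and> wrong_blame F k g \<le> 1" if "k \<in> L" for k g
  proof
    show "0 \<le> wrong_blame F k g"
      using u_nonneg by (auto simp: wrong_blame_def intro: sum_nonneg)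
    have "wrong_blame F k g \<le> sum (u k) F"
      using u_nonneg by (auto simp: wrong_blame_def intro!: sum_mono)
    also have "\<dots> \<le> 1" using that L by (intro sum_u F) auto
    finally show "wrong_blame F k g \<le> 1" .
  qed
  have "\<exists>T>0. \<exists>x. (\<forall>t. x t \<in> {g. \<forall>h. g h \<in> I}) \<and>
      (\<forall>k\<in>L. (\<Sum>t<T. wrong_blame F k (x t)) \<le> real T * (c + c))"
    using best_reply[OF F L] bounds c0 L(1)
    by (intro approachability) (auto simp: c_def)
  then obtain T :: nat and x where T: "T > 0" and x: "\<And>t h. x t h \<in> I"
    and avg: "\<And>k. k \<in> L \<Longrightarrow> (\<Sum>t<T. wrong_blame F k (x t)) \<le> real T * (c + c)"
    by blast
  define votes where "votes h i = card {t\<in>{..<T}. x t h = i}" for h i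
  have "\<exists>j\<in>I. \<forall>i\<in>I. votes h i \<le> votes h j" for h
  proof -
    have "Max (votes h ` I) \<in> votes h ` I"
      using finite_I I_nonempty by (intro Max_in) auto
    then obtain j where "j \<in> I" "votes h j = Max (votes h ` I)" by (auto simp: image_iff)
    then show ?thesis using finite_I by (intro bexI[of _ j]) auto
  qed
  then obtain g where g: "\<And>h. g h \<in> I" "\<And>h i. i \<in> I \<Longrightarrow> votes h i \<le> votes h (g h)"
    by metis
  have half: "real T * of_bool (g h \<noteq> i) \<le> 2 * (\<Sum>t<T. of_bool (x t h \<noteq> i))" if "i \<in> I" for h i
  proof (cases "g h = i")
    case False
    have "votes h (g h) \<le> card {t\<in>{..<T}. x t h \<noteq> i}"
      unfolding votes_def using False by (intro card_mono) auto
    moreover have "card {t\<in>{..<T}. x t h \<noteq> i} + votes h i = T"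
    proof -
      have "{t\<in>{..<T}. x t h \<noteq> i} \<union> {t\<in>{..<T}. x t h = i} = {..<T}" by auto
      then show ?thesis
        unfolding votes_def by (subst card_Un_disjoint[symmetric]) auto
    qed
    ultimately have "T \<le> 2 * card {t\<in>{..<T}. x t h \<noteq> i}"
      using g(2)[OF that, of h] by linarith
    then show ?thesis using False by (simp add: Int_def)
  qed (auto intro: sum_nonneg)
  have "wrong_blame F k g \<le> 4 * c" if k: "k \<in> L" for k
  proof -
    have "real T * wrong_blame F k g = (\<Sum>h\<in>F. (real T * of_bool (g h \<noteq> pl k)) * u k h)"
      by (simp add: wrong_blame_def sum_distrib_left mult_ac)
    also have "\<dots> \<le> (\<Sum>h\<in>F. (2 * (\<Sum>t<T. of_bool (x t h \<noteq> pl k))) * u k h)"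
      using L k pl u_nonneg by (intro sum_mono mult_right_mono half) auto
    also have "\<dots> = 2 * (\<Sum>h\<in>F. \<Sum>t<T. of_bool (x t h \<noteq> pl k) * u k h)"
      by (simp only: sum_distrib_left sum_distrib_right mult.assoc)
    also have "\<dots> = 2 * (\<Sum>t<T. wrong_blame F k (x t))"
      unfolding wrong_blame_def by (subst sum.swap) simp
    also have "\<dots> \<le> 2 * (real T * (c + c))"
      by (intro mult_left_mono avg k) simp
    finally show ?thesis using T by (simp add: algebra_simps)
  qed
  with g(1) show ?thesis by (auto simp: c_def mult.assoc)
qed

text \<open>
  All rules form a compact space, as a product of finite discrete spaces, and the rules that are
  good against \<open>k\<close> on a finite set \<open>F\<close> form a closed subset. Finitely many of these subsets have a
  common point by the plurality vote on the union of the sets \<open>F\<close>.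
\<close>

lemma blame_all_deviations:
  "\<exists>g. (\<forall>h. g h \<in> I) \<and>
     (\<forall>k\<in>K. \<forall>F. finite F \<longrightarrow> F \<subseteq> H \<longrightarrow> wrong_blame F k g \<le> 4 * (real (card I))\<^sup>2 * sqrt \<epsilon>)"
proof (cases "K = {}")
  case True
  then show ?thesis using I_nonempty by auto
next
  case False
  define c where "c = 4 * (real (card I))\<^sup>2 * sqrt \<epsilon>"
  define X where "X = product_topology (\<lambda>_::'h. discrete_topology I) UNIV"
  define C where "C = (\<lambda>(k, F). {g \<in> topspace X. wrong_blame F k g \<le> c})"
  let ?J = "K \<times> {F. finite F \<and> F \<subseteq> H}"
  have X: "g \<in> topspace X \<longleftrightarrow> (\<forall>h. g h \<in> I)" for g
    by (auto simp: X_def)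
  have "closedin X (C (k, F))" if F: "finite F" for k F
  proof -
    have "openin X (topspace X - C (k, F))"
      unfolding X_def openin_product_topology_alt
    proof (intro ballI)
      fix g assume g: "g \<in> topspace (product_topology (\<lambda>_::'h. discrete_topology I) UNIV) - C (k, F)"
      let ?U = "\<lambda>h. if h \<in> F then {g h} else I"
      have gI: "g h \<in> I" for h using g by auto
      \<comment> \<open>rules that agree with \<open>g\<close> on the finite set \<open>F\<close> form a neighbourhood of \<open>g\<close>\<close>
      have same: "wrong_blame F k g' = wrong_blame F k g" if "g' \<in> PiE UNIV ?U" for g'
      proof -
        have "g' h = g h" if "h \<in> F" for h
          using \<open>g' \<in> PiE UNIV ?U\<close> that by (auto simp: PiE_iff dest!: spec[of _ h])
        then show ?thesis by (simp add: wrong_blame_def)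
      qed
      have "PiE UNIV ?U \<subseteq> topspace X"
        using gI by (auto simp: X PiE_iff split: if_splits) metis
      then have "PiE UNIV ?U \<subseteq> topspace X - C (k, F)"
        using g same by (auto simp: C_def X_def)
      moreover have "finite {h \<in> UNIV. ?U h \<noteq> topspace (discrete_topology I)}"
        by (rule finite_subset[OF _ F]) (auto split: if_splits)
      ultimately show "\<exists>U. finite {h \<in> UNIV. U h \<noteq> topspace (discrete_topology I)} \<and>
          (\<forall>h\<in>UNIV. openin (discrete_topology I) (U h)) \<and> g \<in> PiE UNIV U \<and>
          PiE UNIV U \<subseteq> topspace (product_topology (\<lambda>_::'h. discrete_topology I) UNIV) - C (k, F)"
        using gI by (intro exI[of _ ?U]) (auto simp: X_def)
    qed
    then show ?thesis
      by (simp add: closedin_def C_def)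
  qed
  then have closed: "\<forall>S\<in>C ` ?J. closedin X S" by auto
  have fip: "\<Inter>\<F> \<noteq> {}" if "finite \<F>" "\<F> \<subseteq> C ` ?J" for \<F>
  proof -
    obtain J where J: "J \<subseteq> ?J" "finite J" "\<F> = C ` J"
      using finite_subset_image[OF \<open>finite \<F>\<close> \<open>\<F> \<subseteq> C ` ?J\<close>] by blast
    define F where "F = \<Union> (snd ` J)"
    have F: "finite F" "F \<subseteq> H" using J(1,2) unfolding F_def by fastforce+
    obtain g where g: "\<And>h. g h \<in> I" "\<And>k. k \<in> fst ` J \<Longrightarrow> wrong_blame F k g \<le> c"
      using plurality_vote[OF F, of "fst ` J"] J by (force simp: c_def)
    have "g \<in> C (k, F')" if "(k, F') \<in> J" for k F'
    proof -
      have "wrong_blame F' k g \<le> wrong_blame F k g"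
        unfolding wrong_blame_def using that F u_nonneg
        by (intro sum_mono2) (auto simp: F_def)
      also have "\<dots> \<le> c" using that by (intro g(2)) force
      finally show ?thesis using g(1) by (simp add: C_def X)
    qed
    then have "g \<in> \<Inter>\<F>" unfolding J(3) by auto
    then show ?thesis by blast
  qed
  have "compact_space X"
    unfolding X_def using finite_I
    by (auto simp: compact_space_product_topology compact_space_discrete_topology)
  then have "\<Inter> (C ` ?J) \<noteq> {}"
    using closed fip unfolding compact_space_fip by blast
  then obtain g where g: "\<And>k F. k \<in> K \<Longrightarrow> finite F \<Longrightarrow> F \<subseteq> H \<Longrightarrow> g \<in> C (k, F)"
    by auto
  obtain k where "k \<in> K" using False by blast
  from g[OF this, of "{}"] have "\<forall>h. g h \<in> I" by (auto simp: C_def X)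
  with g show ?thesis by (auto simp: C_def c_def)
qed

end

section \<open>Probabilities of histories\<close>

locale finite_game =
  fixes I :: "'i set" and A :: "'i \<Rightarrow> 'a set"
  assumes finite_players: "finite I" and players_nonempty: "I \<noteq> {}"
    and finite_actions: "\<forall>i\<in>I. finite (A i)" and actions_nonempty: "\<And>i. i \<in> I \<Longrightarrow> A i \<noteq> {}"
begin

abbreviation histories :: "('i \<Rightarrow> 'a) list set" where
  "histories \<equiv> lists (profiles I A)"

abbreviation strategy_profile :: "('i \<Rightarrow> ('i, 'a) strategy) \<Rightarrow> bool" where
  "strategy_profile \<sigma> \<equiv> \<forall>i\<in>I. \<sigma> i \<in> behavior_strategies I A i"

definition cylinder :: "('i \<Rightarrow> 'a) list \<Rightarrow> (nat \<Rightarrow> 'i \<Rightarrow> 'a) set" where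
  "cylinder h = {s \<in> plays I A. \<forall>k<length h. s k = h ! k}"

definition history_prob :: "('i \<Rightarrow> ('i, 'a) strategy) \<Rightarrow> ('i \<Rightarrow> 'a) list \<Rightarrow> real" where
  "history_prob \<sigma> h = (\<Prod>k<length h. \<Prod>i\<in>I. pmf (\<sigma> i (take k h)) ((h ! k) i))"

lemma profiles_nonempty: "profiles I A \<noteq> {}"
  using actions_nonempty by (simp add: profiles_def PiE_eq_empty_iff)

lemma finite_profiles: "finite (profiles I A)"
  using finite_players finite_actions by (rule profiles_finite)

lemma countable_histories: "H \<subseteq> histories \<Longrightarrow> countable H"
  by (rule countable_subset[OF _ countable_lists[OF countable_finite[OF finite_profiles]]])

lemma cylinder_sets:
  assumes "h \<in> histories"
  shows "cylinder h \<in> sets (play_borel I A)"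
proof -
  have "{s \<in> space (play_borel I A). s k = h ! k} \<in> sets (play_borel I A)" if "k < length h" for k
    using openin_play_cylinder[of "{h ! k}" I A k] that assms nth_mem[OF that]
    by (auto simp: sets_play_borel intro!: sigma_sets.Basic)
  then have "{s \<in> space (play_borel I A). \<forall>k\<in>{..<length h}. s k = h ! k} \<in> sets (play_borel I A)"
    by (intro sets.sets_Collect_finite_All) auto
  moreover have "cylinder h = {s \<in> space (play_borel I A). \<forall>k\<in>{..<length h}. s k = h ! k}"
    by (auto simp: cylinder_def)
  ultimately show ?thesis by (simp only:)
qed

lemma cylinders_sets: "H \<subseteq> histories \<Longrightarrow> (\<Union>h\<in>H. cylinder h) \<in> sets (play_borel I A)"
  by (rule sets.countable_UN''[OF countable_histories cylinder_sets[OF subsetD]])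

lemma prob_space_plays: "strategy_profile \<sigma> \<Longrightarrow> prob_space (play_measure I A \<sigma>)"
  by (rule prob_space_play_measure[OF finite_players finite_actions])

lemma sets_plays: "strategy_profile \<sigma> \<Longrightarrow> sets (play_measure I A \<sigma>) = sets (play_borel I A)"
  by (rule sets_play_measure[OF finite_players finite_actions])

lemma measure_cylinder:
  assumes \<sigma>: "strategy_profile \<sigma>" and h: "h \<in> histories"
  shows "measure (play_measure I A \<sigma>) (cylinder h) = history_prob \<sigma> h"
proof -
  obtain a where a: "a \<in> profiles I A" using profiles_nonempty by blast
  define x where "x n = (if n < length h then h ! n else a)" for n
  have x: "x \<in> plays I A"
    using a h by (auto simp: plays_def x_def)
  have take: "map x [0..<k] = take k h" if "k < length h" for k
    using that by (intro nth_equalityI) (auto simp: x_def)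
  have "cylinder h = {s \<in> plays I A. \<forall>k<length h. s k = x k}"
    by (auto simp: cylinder_def x_def)
  then have "emeasure (play_measure I A \<sigma>) (cylinder h)
      = (\<Prod>k<length h. \<Prod>i\<in>I. ennreal (pmf (\<sigma> i (map x [0..<k])) (x k i)))"
    using emeasure_play_measure_cylinder[OF finite_players finite_actions \<sigma> x] by simp
  also have "\<dots> = ennreal (history_prob \<sigma> h)"
    by (simp add: take x_def history_prob_def prod_ennreal prod_nonneg)
  finally show ?thesis
    by (simp add: measure_def history_prob_def prod_nonneg)
qed

lemma history_prob_nonneg: "0 \<le> history_prob \<sigma> h"
  by (simp add: history_prob_def prod_nonneg)

text \<open>
  The identity holds factor by factor: if player \<open>i\<close> plays \<open>\<tau>\<close> on one side and complies on the
  other, both sides contain the same two factors of \<open>i\<close>, only distributed differently; likewise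
  for \<open>j\<close>, and the other players comply throughout.
\<close>

lemma history_prob_exchange:
  assumes "i \<noteq> j"
  shows "history_prob (\<sigma>(i := \<tau>)) h * history_prob (\<sigma>(j := \<rho>)) h
       = history_prob \<sigma> h * history_prob (\<sigma>(i := \<tau>, j := \<rho>)) h"
  unfolding history_prob_def prod.distrib[symmetric]
  using assms by (intro prod.cong refl) auto

lemma sum_history_prob:
  assumes \<sigma>: "strategy_profile \<sigma>" and F: "finite F" "F \<subseteq> histories"
    and disj: "disjoint_family_on cylinder F"
  shows "sum (history_prob \<sigma>) F = measure (play_measure I A \<sigma>) (\<Union>h\<in>F. cylinder h)"
proof -
  interpret prob_space "play_measure I A \<sigma>"
    by (rule prob_space_plays[OF \<sigma>])
  have "measure (play_measure I A \<sigma>) (\<Union>h\<in>F. cylinder h)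
      = (\<Sum>h\<in>F. measure (play_measure I A \<sigma>) (cylinder h))"
    using F cylinder_sets unfolding sets_plays[OF \<sigma>, symmetric]
    by (intro finite_measure_finite_Union disj) blast+
  also have "\<dots> = sum (history_prob \<sigma>) F"
    using F by (intro sum.cong refl measure_cylinder \<sigma>) blast
  finally show ?thesis ..
qed

text \<open>Passes from the finite sums that the discrete blame problem controls to the measure of a
  countable union of cylinders.\<close>

lemma measure_cylinders_le:
  assumes \<sigma>: "strategy_profile \<sigma>" and H: "H \<subseteq> histories"
    and disj: "disjoint_family_on cylinder H"
    and le: "\<And>F. finite F \<Longrightarrow> F \<subseteq> H \<Longrightarrow> sum (history_prob \<sigma>) F \<le> c"
  shows "measure (play_measure I A \<sigma>) (\<Union>h\<in>H. cylinder h) \<le> c"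
proof (cases "H = {}")
  case True
  then show ?thesis using le[of "{}"] by simp
next
  case False
  interpret prob_space "play_measure I A \<sigma>"
    by (rule prob_space_plays[OF \<sigma>])
  let ?F = "\<lambda>n. from_nat_into H ` {..<n}"
  have F: "?F n \<subseteq> H" for n using False by (auto intro: from_nat_into)
  have "(\<lambda>n. measure (play_measure I A \<sigma>) (\<Union>h\<in>?F n. cylinder h))
      \<longlonglongrightarrow> measure (play_measure I A \<sigma>) (\<Union>n. \<Union>h\<in>?F n. cylinder h)"
  proof (rule finite_Lim_measure_incseq)
    show "range (\<lambda>n. \<Union>h\<in>?F n. cylinder h) \<subseteq> events"
      using subset_trans[OF F H] by (simp only: sets_plays[OF \<sigma>] cylinders_sets image_subsetI)
    show "incseq (\<lambda>n. \<Union>h\<in>?F n. cylinder h)"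
      by (fastforce simp: incseq_def)
  qed
  moreover have "(\<Union>n. \<Union>h\<in>?F n. cylinder h) = (\<Union>h\<in>H. cylinder h)"
  proof -
    have "(\<Union>n. ?F n) = range (from_nat_into H)" by blast
    also have "\<dots> = H" using range_from_nat_into[OF False countable_histories[OF H]] .
    finally show ?thesis by (metis UN_UN_flatten)
  qed
  moreover have "measure (play_measure I A \<sigma>) (\<Union>h\<in>?F n. cylinder h) \<le> c" for n
    unfolding sum_history_prob[OF \<sigma> _ subset_trans[OF F H] disjoint_family_on_mono[OF F disj],
        symmetric, OF finite_imageI[OF finite_lessThan]]
    by (intro le F) auto
  ultimately show ?thesis
    by (intro LIMSEQ_le_const2) auto
qed

text \<open>
  The discrete blame problem with the histories in \<open>H\<close> as outcomes and all unilateral deviations as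
  \<open>K\<close>. Once a history in \<open>H\<close> occurs, the observer can decide whom to blame.
\<close>

lemma blame_cylinders:
  assumes \<sigma>: "strategy_profile \<sigma>" and H: "H \<subseteq> histories"
    and disj: "disjoint_family_on cylinder H" and \<epsilon>: "0 < \<epsilon>"
    and small: "measure (play_measure I A \<sigma>) (\<Union>h\<in>H. cylinder h) \<le> \<epsilon>"
  shows "\<exists>g. (\<forall>h. g h \<in> I) \<and> (\<forall>i\<in>I. \<forall>\<tau>\<in>behavior_strategies I A i.
     measure (play_measure I A (\<sigma>(i := \<tau>))) (\<Union>h\<in>{h \<in> H. g h \<noteq> i}. cylinder h)
       \<le> 4 * (real (card I))\<^sup>2 * sqrt \<epsilon>)"
proof -
  let ?K = "Sigma I (behavior_strategies I A)"
  let ?u = "\<lambda>(i, \<tau>). history_prob (\<sigma>(i := \<tau>))"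
  let ?z = "\<lambda>(i, \<tau>) (j, \<rho>). history_prob (\<sigma>(i := \<tau>, j := \<rho>))"
  have sum: "sum (history_prob \<sigma>') F = measure (play_measure I A \<sigma>') (\<Union>h\<in>F. cylinder h)"
    if "strategy_profile \<sigma>'" "finite F" "F \<subseteq> H" for \<sigma>' F
    using that H disjoint_family_on_mono[OF _ disj] by (intro sum_history_prob) auto
  have sum_le_1: "sum (history_prob \<sigma>') F \<le> 1"
    if "strategy_profile \<sigma>'" "finite F" "F \<subseteq> H" for \<sigma>' F
    unfolding sum[OF that]
    by (rule prob_space.prob_le_1[OF prob_space_plays[OF that(1)]])
  interpret blame_problem I H ?K fst "history_prob \<sigma>" ?u ?z \<epsilon>
  proof unfold_locales
    fix F assume F: "finite F" "F \<subseteq> H"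
    interpret prob_space "play_measure I A \<sigma>"
      by (rule prob_space_plays[OF \<sigma>])
    have "measure (play_measure I A \<sigma>) (\<Union>h\<in>F. cylinder h) \<le> measure (play_measure I A \<sigma>) (\<Union>h\<in>H. cylinder h)"
      using F cylinders_sets[OF H] sets_plays[OF \<sigma>]
      by (intro finite_measure_mono) auto
    then show "sum (history_prob \<sigma>) F \<le> \<epsilon>"
      using sum[OF \<sigma> F] small by simp
  next
    fix F k assume "finite F" "F \<subseteq> H" "k \<in> ?K"
    then show "sum (?u k) F \<le> 1"
      using \<sigma> sum_le_1[of "\<sigma>(fst k := snd k)" F] by (auto simp: split_beta)
  next
    fix F k l assume "finite F" "F \<subseteq> H" "k \<in> ?K" "l \<in> ?K" "fst k \<noteq> fst l"
    then show "sum (?z k l) F \<le> 1"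
      using \<sigma> sum_le_1[of "\<sigma>(fst k := snd k, fst l := snd l)" F] by (auto simp: split_beta)
  qed (use finite_players players_nonempty \<epsilon> in
    \<open>auto simp: history_prob_nonneg history_prob_exchange split_beta\<close>)
  obtain g where g: "\<forall>h. g h \<in> I" and bound:
    "\<And>i \<tau> F. i \<in> I \<Longrightarrow> \<tau> \<in> behavior_strategies I A i \<Longrightarrow> finite F \<Longrightarrow> F \<subseteq> H \<Longrightarrow>
       wrong_blame F (i, \<tau>) g \<le> 4 * (real (card I))\<^sup>2 * sqrt \<epsilon>"
    using blame_all_deviations by (metis SigmaI)
  have "measure (play_measure I A (\<sigma>(i := \<tau>))) (\<Union>h\<in>{h \<in> H. g h \<noteq> i}. cylinder h)
       \<le> 4 * (real (card I))\<^sup>2 * sqrt \<epsilon>" if i: "i \<in> I" and \<tau>: "\<tau> \<in> behavior_strategies I A i" for i \<tau>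
  proof (rule measure_cylinders_le)
    show "disjoint_family_on cylinder {h \<in> H. g h \<noteq> i}"
      by (rule disjoint_family_on_mono[OF _ disj]) auto
    fix F assume F: "finite F" "F \<subseteq> {h \<in> H. g h \<noteq> i}"
    then have "wrong_blame F (i, \<tau>) g = sum (history_prob (\<sigma>(i := \<tau>))) F"
      unfolding wrong_blame_def by (intro sum.cong) auto
    moreover have "F \<subseteq> H" using F by blast
    ultimately show "sum (history_prob (\<sigma>(i := \<tau>))) F \<le> 4 * (real (card I))\<^sup>2 * sqrt \<epsilon>"
      using bound[OF i \<tau> F(1)] by simp
  qed (use \<sigma> \<tau> H in auto)
  with g show ?thesis by blast
qed

section \<open>Covering null sets by disjoint cylinders\<close>

text \<open>Open sets are disjoint unions of cylinders: stop at the first moment at which the play is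
  certain to stay in \<open>V\<close>.\<close>

lemma minimal_histories:
  assumes V: "V \<subseteq> plays I A" and open_V: "\<And>s. s \<in> V \<Longrightarrow> \<exists>n. cylinder (map s [0..<n]) \<subseteq> V"
  shows "\<exists>H. H \<subseteq> histories \<and> disjoint_family_on cylinder H \<and> (\<Union>h\<in>H. cylinder h) = V"
proof -
  define H where "H = {h \<in> histories. cylinder h \<subseteq> V \<and> (\<forall>k<length h. \<not> cylinder (take k h) \<subseteq> V)}"
  have same: "h = h'" if "h \<in> H" "h' \<in> H" "s \<in> cylinder h" "s \<in> cylinder h'" "length h \<le> length h'" for s h h'
  proof -
    have eq: "h = take (length h) h'"
      using that(3-5) by (intro nth_equalityI) (auto simp: cylinder_def)
    have "cylinder (take (length h) h') \<subseteq> V"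
      using that(1) eq by (simp add: H_def)
    then have "\<not> length h < length h'" using that(2) by (auto simp: H_def)
    then show ?thesis using eq by simp
  qed
  have "disjoint_family_on cylinder H"
    unfolding disjoint_family_on_def using same by (metis disjoint_iff nat_le_linear)
  moreover have "s \<in> (\<Union>h\<in>H. cylinder h)" if s: "s \<in> V" for s
  proof -
    define n where "n = (LEAST n. cylinder (map s [0..<n]) \<subseteq> V)"
    have n: "cylinder (map s [0..<n]) \<subseteq> V"
      unfolding n_def using open_V[OF s] by (rule LeastI_ex)
    have min: "\<not> cylinder (map s [0..<k]) \<subseteq> V" if "k < n" for k
      using that unfolding n_def by (rule not_less_Least)
    have sp: "s \<in> plays I A" using s V by auto
    have "map s [0..<n] \<in> H"
      using n min sp by (auto simp: H_def take_map plays_def PiE_iff)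
    moreover have "s \<in> cylinder (map s [0..<n])"
      using sp by (simp add: cylinder_def)
    ultimately show ?thesis by blast
  qed
  moreover have "(\<Union>h\<in>H. cylinder h) \<subseteq> V" "H \<subseteq> histories"
    by (auto simp: H_def)
  ultimately show ?thesis by blast
qed

text \<open>
  This is outer regularity of finite Borel measures on Polish spaces. Numbering the action profiles
  transports the measure on plays to the type \<open>nat \<Rightarrow> real\<close>, which is a Polish space.
\<close>

lemma null_set_cover:
  assumes \<sigma>: "strategy_profile \<sigma>" and E: "E \<in> null_sets (play_measure I A \<sigma>)" and \<epsilon>: "0 < \<epsilon>"
  shows "\<exists>H. H \<subseteq> histories \<and> disjoint_family_on cylinder H \<and> E \<subseteq> (\<Union>h\<in>H. cylinder h) \<and>
    measure (play_measure I A \<sigma>) (\<Union>h\<in>H. cylinder h) \<le> \<epsilon>"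
proof -
  let ?M = "play_measure I A \<sigma>" and ?P = "profiles I A"
  let ?S = "PiM (UNIV :: nat set) (\<lambda>_. count_space ?P)"
  note fin = finite_players finite_actions
  interpret prob_space ?M
    by (rule prob_space_plays[OF \<sigma>])
  have sets_M: "sets ?M = sets ?S"
    using sets_plays[OF \<sigma>] sets_play_borel_eq_PiM[OF fin] by simp
  have space_M: "space ?M = plays I A" by (rule space_play_measure[OF fin \<sigma>])
  \<comment> \<open>\<open>decode\<close> sends every real sequence to a play, so that preimages of Borel sets of plays
    under it are Borel although the range of \<open>code\<close> is a proper subset\<close>
  define code :: "(nat \<Rightarrow> 'i \<Rightarrow> 'a) \<Rightarrow> nat \<Rightarrow> real" where "code s n = to_nat_on ?P (s n)" for s n
  define decode :: "(nat \<Rightarrow> real) \<Rightarrow> nat \<Rightarrow> 'i \<Rightarrow> 'a"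
    where "decode x n = from_nat_into ?P (nat \<lfloor>x n\<rfloor>)" for x n
  have decode_code: "decode (code s) = s" if "s \<in> plays I A" for s
    using that finite_profiles by (auto simp: decode_def code_def plays_def PiE_iff countable_finite)
  have [measurable]: "code \<in> ?M \<rightarrow>\<^sub>M borel"
  proof (rule measurable_coordinatewise_then_product)
    fix n
    have "(\<lambda>s. s n) \<in> ?S \<rightarrow>\<^sub>M count_space ?P" by measurable
    then have "(\<lambda>s. real (to_nat_on ?P (s n))) \<in> ?S \<rightarrow>\<^sub>M borel"
      by (rule measurable_compose) simp
    then show "(\<lambda>s. code s n) \<in> ?M \<rightarrow>\<^sub>M borel"
      by (simp add: code_def measurable_cong_sets[OF sets_M refl])
  qed
  have [measurable]: "decode \<in> borel \<rightarrow>\<^sub>M ?S"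
  proof (rule measurable_PiM_single')
    fix n
    have "(\<lambda>x::nat \<Rightarrow> real. nat \<lfloor>x n\<rfloor>) \<in> borel \<rightarrow>\<^sub>M count_space UNIV" by measurable
    then have "(\<lambda>x::nat \<Rightarrow> real. from_nat_into ?P (nat \<lfloor>x n\<rfloor>)) \<in> borel \<rightarrow>\<^sub>M count_space ?P"
      by (rule measurable_compose) (simp add: from_nat_into profiles_nonempty)
    then show "(\<lambda>x. decode x n) \<in> borel \<rightarrow>\<^sub>M count_space ?P"
      by (simp add: decode_def)
  qed (auto simp: decode_def[abs_def] from_nat_into profiles_nonempty)
  define N where "N = distr ?M borel code"
  interpret N: prob_space N
    unfolding N_def by (rule prob_space_distr) measurable
  have sets_E: "E \<in> sets ?S" using E sets_M by auto
  have E_plays: "E \<subseteq> plays I A"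
    using sets.sets_into_space[OF null_setsD2[OF E]] by (simp add: space_M)
  define B where "B = decode -` E"
  have B: "B \<in> sets borel"
    using measurable_sets[OF \<open>decode \<in> borel \<rightarrow>\<^sub>M ?S\<close> sets_E] by (simp add: B_def)
  have "code -` B \<inter> space ?M = E"
    using E_plays by (auto simp: B_def space_M decode_code subset_iff)
  then have "emeasure N B = 0"
    using null_setsD1[OF E] B by (simp add: N_def emeasure_distr)
  moreover have "emeasure N B = (INF U \<in> {U. B \<subseteq> U \<and> open U}. emeasure N U)"
    by (rule outer_regular) (use B in \<open>simp_all add: N_def[symmetric]\<close>, simp_all add: N_def)
  ultimately have "(INF U \<in> {U. B \<subseteq> U \<and> open U}. emeasure N U) < ennreal \<epsilon>"
    using \<epsilon> by simp
  then obtain U where U: "B \<subseteq> U" "open U" "emeasure N U < ennreal \<epsilon>"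
    unfolding INF_less_iff by blast
  define V where "V = code -` U \<inter> plays I A"
  have V: "emeasure ?M V < ennreal \<epsilon>"
    using U by (simp add: V_def N_def emeasure_distr space_M)
  have "\<exists>n. cylinder (map s [0..<n]) \<subseteq> V" if s: "s \<in> V" for s
  proof -
    have op: "openin (product_topology (\<lambda>_. euclidean) UNIV) U"
      using U(2) by (simp add: open_fun_def)
    have "code s \<in> U" using s by (simp add: V_def)
    from product_topology_open_contains_basis[OF op this] obtain X where X: "code s \<in> PiE UNIV X"
        "finite {i. X i \<noteq> topspace euclidean}" "PiE UNIV X \<subseteq> U"
      by auto
    obtain n where n: "\<And>i. X i \<noteq> UNIV \<Longrightarrow> i < n"
      using X(2) finite_nat_set_iff_bounded by auto
    have "code t \<in> U" if t: "t \<in> cylinder (map s [0..<n])" for t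
    proof -
      have "code t i \<in> X i" for i
      proof (cases "i < n")
        case True
        then have "t i = s i" using t by (simp add: cylinder_def)
        then show ?thesis using X(1) by (auto simp: code_def PiE_iff)
      qed (use n in auto)
      then show ?thesis using X(3) by auto
    qed
    then show ?thesis by (auto simp: V_def cylinder_def)
  qed
  from minimal_histories[OF _ this] obtain H where
    H: "H \<subseteq> histories" "disjoint_family_on cylinder H" "(\<Union>h\<in>H. cylinder h) = V"
    by (auto simp: V_def)
  have "E \<subseteq> V"
    using U(1) E_plays by (auto simp: V_def B_def decode_code subset_iff)
  moreover have "measure ?M V \<le> \<epsilon>"
    using V \<epsilon> by (simp add: emeasure_eq_measure ennreal_less_iff)
  ultimately show ?thesis using H by blast
qed

section \<open>Blaming the player who is accused infinitely often\<close>

text \<open>Taking the least index in an enumeration of the players makes the choice measurable.\<close>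

lemma measurable_persistent_choice:
  fixes C :: "nat \<Rightarrow> 'i \<Rightarrow> 's set"
  assumes [measurable]: "\<And>n i. i \<in> I \<Longrightarrow> C n i \<in> sets M"
  shows "(\<lambda>s. from_nat_into I (LEAST m. \<forall>N. \<exists>n\<ge>N. s \<in> C n (from_nat_into I m)))
    \<in> M \<rightarrow>\<^sub>M count_space I"
proof -
  have [measurable]: "C n (from_nat_into I m) \<in> sets M" for n m
    using from_nat_into[OF players_nonempty] assms by auto
  have "(\<lambda>s. LEAST m. \<forall>N. \<exists>n\<ge>N. s \<in> C n (from_nat_into I m)) \<in> M \<rightarrow>\<^sub>M count_space UNIV"
    by measurable
  then show ?thesis
    by (rule measurable_compose) (simp add: from_nat_into players_nonempty)
qed

text \<open>
  On \<open>E\<close> every rule blames somebody, so by the pigeonhole principle some player is blamed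
  infinitely often. Under a deviation of \<open>i\<close>, the plays on which infinitely many rules blame
  somebody else form a null set, because the error probabilities are summable.
\<close>

lemma testable_if_complement_null:
  assumes \<sigma>: "strategy_profile \<sigma>" and null: "plays I A - D \<in> null_sets (play_measure I A \<sigma>)"
  shows "testable 0 I A \<sigma> D"
proof -
  define E where "E = plays I A - D"
  \<comment> \<open>chosen so that the error bound \<open>4 |I|\<^sup>2 sqrt (\<epsilon> n)\<close> of \<open>blame_cylinders\<close> is \<open>(1/2)\<^sup>n\<close>\<close>
  define \<epsilon> where "\<epsilon> n = ((1/2) ^ n / (4 * (real (card I))\<^sup>2))\<^sup>2" for n :: nat
  have card: "0 < real (card I)"
    using finite_players players_nonempty by (simp add: card_gt_0_iff)
  have \<epsilon>: "0 < \<epsilon> n" "4 * (real (card I))\<^sup>2 * sqrt (\<epsilon> n) = (1/2) ^ n" for n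
    using card by (simp_all add: \<epsilon>_def)
  have "\<exists>H. H \<subseteq> histories \<and> disjoint_family_on cylinder H \<and> E \<subseteq> (\<Union>h\<in>H. cylinder h) \<and>
    measure (play_measure I A \<sigma>) (\<Union>h\<in>H. cylinder h) \<le> \<epsilon> n" for n
    unfolding E_def by (rule null_set_cover[OF \<sigma> null \<epsilon>(1)])
  then obtain H where H: "\<And>n. H n \<subseteq> histories" "\<And>n. disjoint_family_on cylinder (H n)"
      "\<And>n. E \<subseteq> (\<Union>h\<in>H n. cylinder h)"
      "\<And>n. measure (play_measure I A \<sigma>) (\<Union>h\<in>H n. cylinder h) \<le> \<epsilon> n"
    by metis
  define innocents_safe where "innocents_safe n g \<longleftrightarrow>
      (\<forall>h. g h \<in> I) \<and> (\<forall>i\<in>I. \<forall>\<tau>\<in>behavior_strategies I A i.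
        measure (play_measure I A (\<sigma>(i := \<tau>))) (\<Union>h\<in>{h \<in> H n. g h \<noteq> i}. cylinder h) \<le> (1/2) ^ n)"
    for n g
  have "\<exists>g. innocents_safe n g" for n
    using blame_cylinders[OF \<sigma> H(1,2) \<epsilon>(1) H(4)] unfolding innocents_safe_def \<epsilon>(2) .
  then obtain g where "\<And>n. innocents_safe n (g n)" by metis
  then have g: "\<And>n h. g n h \<in> I"
    and small: "\<And>n i \<tau>. i \<in> I \<Longrightarrow> \<tau> \<in> behavior_strategies I A i \<Longrightarrow>
     measure (play_measure I A (\<sigma>(i := \<tau>))) (\<Union>h\<in>{h \<in> H n. g n h \<noteq> i}. cylinder h) \<le> (1/2) ^ n"
    by (simp_all add: innocents_safe_def)
  define accuses where "accuses n i = (\<Union>h\<in>{h \<in> H n. g n h = i}. cylinder h)" for n i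
  define accuses_other where "accuses_other i n = (\<Union>h\<in>{h \<in> H n. g n h \<noteq> i}. cylinder h)" for n i
  define often where "often s i \<longleftrightarrow> (\<forall>N. \<exists>n\<ge>N. s \<in> accuses n i)" for s i
  define f where "f s = from_nat_into I (LEAST m. often s (from_nat_into I m))" for s
  have sets: "accuses n i \<in> sets (play_borel I A)" "accuses_other i n \<in> sets (play_borel I A)" for n i
    unfolding accuses_def accuses_other_def using H(1)[of n] by (intro cylinders_sets; blast)+
  have f_often: "often s (f s)" if s: "s \<in> E" for s
  proof -
    have "\<exists>i\<in>I. s \<in> accuses n i" for n
      using s H(3)[of n] g by (force simp: accuses_def)
    then obtain b where b: "\<And>n. b n \<in> I" "\<And>n. s \<in> accuses n (b n)" by metis
    have "\<exists>i\<in>I. infinite {n. b n = i}"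
    proof (rule ccontr)
      assume "\<not> ?thesis"
      then have "finite (\<Union>i\<in>I. {n. b n = i})" using finite_players by auto
      moreover have "(\<Union>i\<in>I. {n. b n = i}) = UNIV" using b(1) by auto
      ultimately show False by simp
    qed
    then obtain i where i: "i \<in> I" "infinite {n. b n = i}" by blast
    then have "often s i"
      unfolding often_def infinite_nat_iff_unbounded_le using b(2) by blast
    moreover obtain m where "i = from_nat_into I m"
      using i(1) finite_players by (metis countable_finite from_nat_into_to_nat_on)
    ultimately show ?thesis
      unfolding f_def by (metis (mono_tags, lifting) LeastI)
  qed
  have "f \<in> restrict_space (play_borel I A) E \<rightarrow>\<^sub>M count_space I"
    unfolding f_def often_def
    by (intro measurable_restrict_space1 measurable_persistent_choice sets)
  moreover have "measure (play_measure I A (\<sigma>(i := \<tau>))) {s \<in> E. f s \<noteq> i} \<le> 0"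
    if i: "i \<in> I" and \<tau>: "\<tau> \<in> behavior_strategies I A i" for i \<tau>
  proof -
    let ?M = "play_measure I A (\<sigma>(i := \<tau>))"
    have \<sigma>': "strategy_profile (\<sigma>(i := \<tau>))" using \<sigma> \<tau> by auto
    interpret prob_space ?M
      by (rule prob_space_plays[OF \<sigma>'])
    have "limsup (accuses_other i) \<in> null_sets ?M"
    proof (rule borel_cantelli_limsup1)
      show "accuses_other i n \<in> sets ?M" for n
        by (simp only: sets sets_plays[OF \<sigma>'])
      show "summable (\<lambda>n. measure ?M (accuses_other i n))"
        by (rule summable_comparison_test'[of "\<lambda>n. (1/2::real) ^ n"])
          (use small[OF i \<tau>] in \<open>auto simp: accuses_other_def summable_geometric\<close>)
    qed (simp add: emeasure_eq_measure)
    moreover have "{s \<in> E. f s \<noteq> i} \<subseteq> limsup (accuses_other i)"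
    proof safe
      fix s assume s: "s \<in> E" "f s \<noteq> i"
      have "accuses n (f s) \<subseteq> accuses_other i n" for n
        using s(2) by (auto simp: accuses_def accuses_other_def)
      then show "s \<in> limsup (accuses_other i)"
        using f_often[OF s(1)] by (fastforce simp: often_def limsup_INF_SUP)
    qed
    ultimately have "measure ?M {s \<in> E. f s \<noteq> i} \<le> measure ?M (limsup (accuses_other i))"
      by (intro finite_measure_mono) auto
    also have "\<dots> = 0"
      using \<open>limsup (accuses_other i) \<in> null_sets ?M\<close> by (simp add: measure_eq_0_null_sets)
    finally show ?thesis .
  qed
  ultimately show ?thesis
    unfolding testable_def blame_functions_def E_def by blast
qed

end

section \<open>Testability\<close>

theorem theorem2p9:
  fixes I :: "'i set" and A :: "'i \<Rightarrow> 'a set"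
    and \<sigma> :: "'i \<Rightarrow> ('i, 'a) strategy" and D :: "(nat \<Rightarrow> 'i \<Rightarrow> 'a) set"
  assumes "finite I" and "I \<noteq> {}"
    and "\<forall>i\<in>I. finite (A i) \<and> A i \<noteq> {}"
    and "goal I A \<sigma> D"
    and "measure (play_measure I A \<sigma>) D = 1"
  shows "testable 0 I A \<sigma> D"
proof -
  interpret finite_game I A
    using assms(1-3) by unfold_locales auto
  have \<sigma>: "strategy_profile \<sigma>" and D: "D \<in> sets (play_borel I A)"
    using assms(4) by (auto simp: goal_def)
  interpret prob_space "play_measure I A \<sigma>"
    by (rule prob_space_plays[OF \<sigma>])
  have sets: "sets (play_measure I A \<sigma>) = sets (play_borel I A)"
    and space: "space (play_measure I A \<sigma>) = plays I A"
    by (rule sets_plays[OF \<sigma>]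
        space_play_measure[OF finite_players finite_actions \<sigma>])+
  have "measure (play_measure I A \<sigma>) (plays I A - D) = 0"
    using prob_compl[of D] D assms(5) by (simp add: sets space)
  then have "plays I A - D \<in> null_sets (play_measure I A \<sigma>)"
    using D sets.compl_sets[of D "play_borel I A"]
    by (intro null_setsI) (simp_all add: sets emeasure_eq_measure)
  with \<sigma> show ?thesis
    by (rule testable_if_complement_null)
qed

end
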